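(* Let $n\ge 1$, $k\ge 2$, and let $\varphi$ be an arbitrary distance regular $k$-coloring of $\mathbb{Z}^n$ (colors numbered in the standard order), with lower degrees $l_2,\ldots,l_k$ and upper degrees $u_1,\ldots,u_{k-1}$. Then $$l_2\le l_3\le\ldots\le l_{k-1}\le l_k \qquad\text{and}\qquad u_1\ge u_2\ge\ldots\ge u_{k-1}.$$
   Context: $\mathbb{Z}^n$ denotes the infinite graph of the $n$-dimensional rectangular grid: its vertices are the integer vectors, and ${\bf x},{\bf y}$ are adjacent iff ${\bf y}-{\bf x}\in\{\pm{\bf e^1},\ldots,\pm{\bf e^n}\}$, where ${\bf e^i}$ is the $i$-th unit coordinate vector. A $k$-coloring is a function $\varphi$ from the vertices to $\{1,\ldots,k\}$, equivalently a partition of the vertices into $k$ (nonempty) color classes $C_i=\varphi^{-1}(i)$. It is perfect with parameter matrix $A=(\alpha_{ij})_{k\times k}$ if, for all $i,j$, every vertex of color $i$ has exactly $\alpha_{ij}$ neighbors of color $j$. A perfect coloring is distance regular if for some ordering of the colors (a standard order) the parameter matrix is three-diagonal; the colors are assumed to be numbered in a standard order, so $\alpha_{ij}=0$ whenever $|i-j|>1$. For a distance regular coloring, $l_i=\alpha_{i,i-1}$ ($2\le i\le k$) is the lower degree and $u_i=\alpha_{i,i+1}$ ($1\le i\le k-1$) is the upper degree of color $i$. *)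

theory Defs
  imports "HOL-Analysis.Finite_Cartesian_Product"
begin

text \<open>
  The vertex set of the grid \<open>\<int>\<^sup>n\<close> is the type \<^typ>\<open>int ^ 'n\<close> with \<open>n = CARD('n)\<close>; since types
  are nonempty, \<open>n \<ge> 1\<close>.
\<close>

definition grid_adj :: "int ^ 'n \<Rightarrow> int ^ 'n \<Rightarrow> bool" where
  "grid_adj x y \<longleftrightarrow> (\<exists>i. y - x = axis i 1 \<or> y - x = - axis i 1)"

text \<open>Neighbourhoods are finite, so \<^const>\<open>card\<close> really counts neighbours below.\<close>

lemma finite_grid_neighbours: "finite {y. grid_adj x y}"
proof -
  have "{y. grid_adj x y} \<subseteq> range (\<lambda>i. x + axis i 1) \<union> range (\<lambda>i. x + - axis i 1)"
    by (auto simp: grid_adj_def algebra_simps image_iff)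
  then show ?thesis
    by (rule finite_subset) simp
qed

definition coloring :: "nat \<Rightarrow> (int ^ 'n \<Rightarrow> nat) \<Rightarrow> bool" where
  "coloring k \<phi> \<longleftrightarrow> range \<phi> = {1..k}"

text \<open>
  Matrices are functions on pairs of indices; only the entries with both indices in \<open>{1..k}\<close>
  are meaningful.
\<close>

definition perfect_coloring :: "nat \<Rightarrow> (nat \<Rightarrow> nat \<Rightarrow> nat) \<Rightarrow> (int ^ 'n \<Rightarrow> nat) \<Rightarrow> bool" where
  "perfect_coloring k A \<phi> \<longleftrightarrow> coloring k \<phi> \<and>
     (\<forall>i\<in>{1..k}. \<forall>j\<in>{1..k}. \<forall>x. \<phi> x = i \<longrightarrow> card {y. grid_adj x y \<and> \<phi> y = j} = A i j)"

definition tridiagonal :: "nat \<Rightarrow> (nat \<Rightarrow> nat \<Rightarrow> nat) \<Rightarrow> bool" where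
  "tridiagonal k A \<longleftrightarrow> (\<forall>i\<in>{1..k}. \<forall>j\<in>{1..k}. \<bar>int i - int j\<bar> > 1 \<longrightarrow> A i j = 0)"

text \<open>A distance regular coloring whose colors are already numbered in a standard order.\<close>

definition distance_regular_coloring ::
  "nat \<Rightarrow> (nat \<Rightarrow> nat \<Rightarrow> nat) \<Rightarrow> (int ^ 'n \<Rightarrow> nat) \<Rightarrow> bool" where
  "distance_regular_coloring k A \<phi> \<longleftrightarrow> perfect_coloring k A \<phi> \<and> tridiagonal k A"

text \<open>The lower degree is used for colors \<open>2..k\<close> only, the upper degree for \<open>1..k-1\<close> only.\<close>

definition lower_degree :: "(nat \<Rightarrow> nat \<Rightarrow> nat) \<Rightarrow> nat \<Rightarrow> nat" where
  "lower_degree A i = A i (i - 1)"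

definition upper_degree :: "(nat \<Rightarrow> nat \<Rightarrow> nat) \<Rightarrow> nat \<Rightarrow> nat" where
  "upper_degree A i = A i (i + 1)"

end

theory Submission imports Defs begin

text \<open>
  Along an edge of the grid the color changes by at most one, because the parameter matrix is
  tridiagonal. Take an edge \<open>y x\<close> whose ends have colors \<open>j\<close> and \<open>j + 1\<close>, and slide it in any
  direction \<open>e\<close> for which \<open>y + e\<close> has color \<open>j - 1\<close>. The vertex \<open>x + e\<close> is adjacent to \<open>x\<close>, of
  color \<open>j + 1\<close>, and to \<open>y + e\<close>, of color \<open>j - 1\<close>, so its color must be \<open>j\<close>. Sliding thus injects the
  neighbors of \<open>y\<close> counted by the lower degree of \<open>j\<close> into the neighbors of \<open>x\<close> counted by the
  lower degree of \<open>j + 1\<close>. With the order of the colors reversed, the same argument compares the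
  upper degrees; \<open>card_neighbours_slide\<close> covers both directions at once. What remains is that
  consecutive colors do meet along some edge (\<open>consecutive_colors_adjacent\<close>), which follows
  from the connectedness of the grid (\<open>grid_connected\<close>).
\<close>

lemma grid_adj_sym: "grid_adj x y \<Longrightarrow> grid_adj y x"
  unfolding grid_adj_def by (metis minus_diff_eq minus_minus)

lemma grid_adj_translate: "grid_adj (x + d) (y + d) \<longleftrightarrow> grid_adj x y"
  by (simp add: grid_adj_def)

lemma grid_adj_translate_diff: "grid_adj z (z + (x - y)) \<longleftrightarrow> grid_adj y x"
  by (simp add: grid_adj_def)

text \<open>
  Connectedness in the form of an induction principle. A vertex reaches any other by walking
  along one coordinate after another, which is the expansion of their difference in unit vectors.
\<close>

lemma grid_connected:
  fixes S :: "(int ^ 'n) set"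
  assumes start: "x \<in> S"
    and closed: "\<And>a b. a \<in> S \<Longrightarrow> grid_adj a b \<Longrightarrow> b \<in> S"
  shows "y \<in> S"
proof -
  have line: "a + axis i m \<in> S" if "a \<in> S" for a i m
  proof (induction m rule: int_induct[where k = 0])
    case base
    have "a + axis i 0 = a"
      by (simp add: vec_eq_iff axis_def)
    then show ?case
      using that by (simp only:)
  next
    case (step1 m)
    have "(a + axis i (m + 1)) - (a + axis i m) = axis i 1"
      by (simp add: vec_eq_iff axis_def)
    then show ?case
      using closed[OF step1(2)] unfolding grid_adj_def by blast
  next
    case (step2 m)
    have "(a + axis i (m - 1)) - (a + axis i m) = - axis i 1"
      by (simp add: vec_eq_iff axis_def)
    then show ?case
      using closed[OF step2(2)] unfolding grid_adj_def by blast
  qed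
  have "x + (\<Sum>i\<in>I. axis i ((y - x) $ i)) \<in> S" for I
    using finite[of I]
  proof (induction I rule: finite_induct)
    case empty
    then show ?case using start by simp
  next
    case (insert i I)
    then show ?case
      using line[OF insert.IH, of i "(y - x) $ i"] by (simp add: ac_simps)
  qed
  moreover have "(\<Sum>i\<in>UNIV. axis i ((y - x) $ i)) = y - x"
    by (simp add: vec_eq_iff axis_def)
  ultimately show ?thesis
    by (metis add.commute diff_add_cancel)
qed

lemma color_in_range:
  assumes "distance_regular_coloring k A \<phi>"
  shows "\<phi> x \<in> {1..k}"
  using assms unfolding distance_regular_coloring_def perfect_coloring_def coloring_def by blast

lemma card_neighbours_of_color:
  assumes "distance_regular_coloring k A \<phi>" and "j \<in> {1..k}"
  shows "card {y. grid_adj x y \<and> \<phi> y = j} = A (\<phi> x) j"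
  using assms color_in_range[OF assms(1), of x]
  unfolding distance_regular_coloring_def perfect_coloring_def by blast

lemma finite_neighbours_of_color: "finite {y. grid_adj x y \<and> \<phi> y = j}"
  by (rule finite_subset[OF _ finite_grid_neighbours[of x]]) auto

lemma adjacent_colors_differ_le_1:
  assumes dr: "distance_regular_coloring k A \<phi>" and adj: "grid_adj x y"
  shows "\<bar>int (\<phi> x) - int (\<phi> y)\<bar> \<le> 1"
proof (rule ccontr)
  assume "\<not> ?thesis"
  then have "A (\<phi> x) (\<phi> y) = 0"
    using dr color_in_range[OF dr] unfolding distance_regular_coloring_def tridiagonal_def
    by (meson not_le)
  then have "card {z. grid_adj x z \<and> \<phi> z = \<phi> y} = 0"
    using card_neighbours_of_color[OF dr color_in_range[OF dr]] by simp
  then have "{z. grid_adj x z \<and> \<phi> z = \<phi> y} = {}"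
    by (simp only: card_0_eq[OF finite_neighbours_of_color])
  then show False
    using adj by blast
qed

text \<open>
  Otherwise no edge would leave the set of vertices of color at most \<open>i\<close>, and by connectedness
  the color \<open>i + 1\<close> would not occur.
\<close>

lemma consecutive_colors_adjacent:
  assumes dr: "distance_regular_coloring k A \<phi>" and i: "1 \<le> i" "i < k"
  obtains x y where "grid_adj x y" "\<phi> x = i" "\<phi> y = i + 1"
proof (rule ccontr)
  assume no_edge: "\<not> thesis"
  have onto: "range \<phi> = {1..k}"
    using dr unfolding distance_regular_coloring_def perfect_coloring_def coloring_def by blast
  then have "i \<in> range \<phi>" and "i + 1 \<in> range \<phi>"
    using i by simp_all
  then obtain a b where a: "\<phi> a = i" and b: "\<phi> b = i + 1"
    by (metis imageE)
  have "b \<in> {x. \<phi> x \<le> i}"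
  proof (rule grid_connected)
    show "a \<in> {x. \<phi> x \<le> i}" using a by simp
  next
    fix u v
    assume u: "u \<in> {x. \<phi> x \<le> i}" and uv: "grid_adj u v"
    have "\<not> (\<phi> u = i \<and> \<phi> v = i + 1)"
      using that[OF uv] no_edge by blast
    then show "v \<in> {x. \<phi> x \<le> i}"
      using u adjacent_colors_differ_le_1[OF dr uv] by auto
  qed
  then show False using b by simp
qed

text \<open>
  The sliding argument. The colors \<open>c\<close>, \<open>\<phi> y\<close>, \<open>\<phi> x\<close> are consecutive, in increasing or in
  decreasing order, so \<open>\<phi> y\<close> is the only color within distance one of both \<open>c\<close> and \<open>\<phi> x\<close>; this
  forces the color of the fourth vertex of the parallelogram. In the direction of \<open>y - x\<close> the
  parallelogram is flat, with fourth vertex \<open>y\<close>, and the argument applies unchanged.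
\<close>

lemma card_neighbours_slide:
  assumes dr: "distance_regular_coloring k A \<phi>" and adj: "grid_adj y x"
    and step: "\<bar>int (\<phi> y) - int (\<phi> x)\<bar> = 1"
    and consecutive: "int c - int (\<phi> y) = int (\<phi> y) - int (\<phi> x)"
  shows "card {z. grid_adj y z \<and> \<phi> z = c} \<le> card {z. grid_adj x z \<and> \<phi> z = \<phi> y}"
proof (rule card_inj_on_le)
  show "inj_on (\<lambda>z. z + (x - y)) {z. grid_adj y z \<and> \<phi> z = c}"
    by (simp add: inj_on_def)
  show "finite {z. grid_adj x z \<and> \<phi> z = \<phi> y}"
    by (rule finite_neighbours_of_color)
  show "(\<lambda>z. z + (x - y)) ` {z. grid_adj y z \<and> \<phi> z = c} \<subseteq> {z. grid_adj x z \<and> \<phi> z = \<phi> y}"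
  proof (rule image_subsetI)
    fix z
    assume z: "z \<in> {z. grid_adj y z \<and> \<phi> z = c}"
    let ?w = "z + (x - y)"
    have xw: "grid_adj x ?w"
      using z grid_adj_translate[of y "x - y" z] by simp
    have zw: "grid_adj z ?w"
      using adj by (simp only: grid_adj_translate_diff)
    have "\<phi> ?w = \<phi> y"
      using adjacent_colors_differ_le_1[OF dr xw] adjacent_colors_differ_le_1[OF dr zw]
        z step consecutive by auto
    then show "?w \<in> {z. grid_adj x z \<and> \<phi> z = \<phi> y}"
      using xw by simp
  qed
qed

theorem theorem1:
  fixes \<phi> :: "int ^ 'n \<Rightarrow> nat" and A :: "nat \<Rightarrow> nat \<Rightarrow> nat" and k :: nat
  assumes "k \<ge> 2"
    and "distance_regular_coloring k A \<phi>"
  shows "(\<forall>i. 2 \<le> i \<and> i + 1 \<le> k \<longrightarrow> lower_degree A i \<le> lower_degree A (i + 1)) \<and>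
         (\<forall>i. 1 \<le> i \<and> i + 1 \<le> k - 1 \<longrightarrow> upper_degree A i \<ge> upper_degree A (i + 1))"
proof (intro conjI allI impI)
  note dr = assms(2)
  fix i
  assume i: "2 \<le> i \<and> i + 1 \<le> k"
  obtain y x where yx: "grid_adj y x" "\<phi> y = i" "\<phi> x = i + 1"
    using consecutive_colors_adjacent[OF dr, of i] i by auto
  have "card {z. grid_adj y z \<and> \<phi> z = i - 1} \<le> card {z. grid_adj x z \<and> \<phi> z = \<phi> y}"
    using i yx by (intro card_neighbours_slide[OF dr]) auto
  moreover have "i - 1 \<in> {1..k}"
    using i by auto
  ultimately show "lower_degree A i \<le> lower_degree A (i + 1)"
    using i yx card_neighbours_of_color[OF dr, of "i - 1" y] card_neighbours_of_color[OF dr, of i x]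
    by (simp add: lower_degree_def)
next
  note dr = assms(2)
  fix i
  assume i: "1 \<le> i \<and> i + 1 \<le> k - 1"
  then have "1 \<le> i" "i < k" "i + 2 \<in> {1..k}"
    by auto
  obtain x y where xy: "grid_adj x y" "\<phi> x = i" "\<phi> y = i + 1"
    using consecutive_colors_adjacent[OF dr \<open>1 \<le> i\<close> \<open>i < k\<close>] .
  have "card {z. grid_adj y z \<and> \<phi> z = i + 2} \<le> card {z. grid_adj x z \<and> \<phi> z = \<phi> y}"
    using i xy by (intro card_neighbours_slide[OF dr grid_adj_sym]) auto
  then show "upper_degree A i \<ge> upper_degree A (i + 1)"
    using i xy \<open>i + 2 \<in> {1..k}\<close> card_neighbours_of_color[OF dr, of "i + 2" y]
      card_neighbours_of_color[OF dr, of "i + 1" x]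
    by (simp add: upper_degree_def)
qed

end
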